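(* Let $G$ be a connected interval graph, $K$ an end-clique of $G$, and $H$ an arbitrary connected graph vertex disjoint from $G$. If $G'=\mathrm{aug}(G,K,H)$, then $\sigma^{\boxtimes}_V(G')=1$.
   Context: All graphs are finite, simple and non-empty. An interval representation of a graph is a family of (closed) intervals of the real line assigned to the vertices so that two distinct vertices are adjacent if and only if the corresponding intervals intersect; a graph is an interval graph if it has an interval representation. In an interval representation write $I_v=[l_v,r_v]$ for the interval of $v$. A vertex $v$ of an interval graph $G$ is an end-vertex if there exists an interval representation of $G$ such that $l_v=\min\{l_u \mid u\in V(G)\}$ or $r_v=\max\{r_u\mid u\in V(G)\}$. A maximal clique of $G$ is an end-clique if it contains an end-vertex of $G$. For connected vertex disjoint graphs $G$ and $H$ and $S\subseteq V(G)$, the augmentation of $G$ with respect to $S$ and $H$ is the graph $\mathrm{aug}(G,S,H)$ with vertex set $V(G)\cup V(H)$ and edge set $E(G)\cup E(H)\cup\{sh \mid s\in S,\ h\in V(H)\}$. A function $f: V(P)\to V(H)$ is a weak homomorphism $f:P\to H$ if for every edge $uv\in E(P)$ either $f(u)f(v)\in E(H)$ or $f(u)=f(v)$; it is surjective if $f(V(P))=V(H)$. For weak homomorphisms $f,g:P\to H$ put $m_P(f,g)=\min\{d_H(f(u),g(u)) \mid u\in V(P)\}$, where $d_H$ is the shortest-path distance. For a connected graph $H$, the strong vertex span is $\sigma^{\boxtimes}_V(H)=\max\{m_P(f,g) \mid f,g:P\to H$ are surjective weak homomorphisms and $P$ is a path$\}$. *)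

theory Defs
  imports "Graph_Theory.Graph_Theory"
begin

text \<open>
  A finite simple graph is a \<open>pair_graph\<close>: a finite, loop-free, symmetric arc relation on a vertex
  set. Each edge \<open>uv\<close> occurs as the two arcs \<open>(u, v)\<close> and \<open>(v, u)\<close>. Non-emptiness is part of
  \<open>Digraph_Component.connected\<close>.
\<close>

definition interval_rep :: "'a pair_pre_digraph \<Rightarrow> ('a \<Rightarrow> real) \<Rightarrow> ('a \<Rightarrow> real) \<Rightarrow> bool" where
  "interval_rep G l r \<longleftrightarrow>
    (\<forall>v\<in>pverts G. l v \<le> r v) \<and>
    (\<forall>u\<in>pverts G. \<forall>v\<in>pverts G. u \<noteq> v \<longrightarrow>
      ((u, v) \<in> parcs G \<longleftrightarrow> {l u..r u} \<inter> {l v..r v} \<noteq> {}))"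

definition interval_graph :: "'a pair_pre_digraph \<Rightarrow> bool" where
  "interval_graph G \<longleftrightarrow> pair_graph G \<and> (\<exists>l r. interval_rep G l r)"

definition end_vertex :: "'a pair_pre_digraph \<Rightarrow> 'a \<Rightarrow> bool" where
  "end_vertex G v \<longleftrightarrow> v \<in> pverts G \<and>
    (\<exists>l r. interval_rep G l r \<and> (l v = Min (l ` pverts G) \<or> r v = Max (r ` pverts G)))"

definition clique :: "'a pair_pre_digraph \<Rightarrow> 'a set \<Rightarrow> bool" where
  "clique G K \<longleftrightarrow> K \<subseteq> pverts G \<and> pairwise (\<lambda>u v. (u, v) \<in> parcs G) K"

definition maximal_clique :: "'a pair_pre_digraph \<Rightarrow> 'a set \<Rightarrow> bool" where
  "maximal_clique G K \<longleftrightarrow> clique G K \<and> (\<forall>K'. clique G K' \<and> K \<subseteq> K' \<longrightarrow> K' = K)"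

definition end_clique :: "'a pair_pre_digraph \<Rightarrow> 'a set \<Rightarrow> bool" where
  "end_clique G K \<longleftrightarrow> maximal_clique G K \<and> (\<exists>v\<in>K. end_vertex G v)"

definition aug :: "'a pair_pre_digraph \<Rightarrow> 'a set \<Rightarrow> 'a pair_pre_digraph \<Rightarrow> 'a pair_pre_digraph" where
  "aug G S H = \<lparr> pverts = pverts G \<union> pverts H,
     parcs = parcs G \<union> parcs H \<union> S \<times> pverts H \<union> pverts H \<times> S \<rparr>"

text \<open>The path with \<open>n\<close> vertices; every path is isomorphic to exactly one of these with \<open>n > 0\<close>.\<close>

definition path_graph :: "nat \<Rightarrow> nat pair_pre_digraph" where
  "path_graph n = \<lparr> pverts = {..<n}, parcs = {(i, j). i < n \<and> j < n \<and> (j = Suc i \<or> i = Suc j)} \<rparr>"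

definition weak_hom :: "'p pair_pre_digraph \<Rightarrow> 'a pair_pre_digraph \<Rightarrow> ('p \<Rightarrow> 'a) \<Rightarrow> bool" where
  "weak_hom P H f \<longleftrightarrow> f ` pverts P \<subseteq> pverts H \<and>
    (\<forall>(u, v)\<in>parcs P. (f u, f v) \<in> parcs H \<or> f u = f v)"

definition surj_weak_hom :: "'p pair_pre_digraph \<Rightarrow> 'a pair_pre_digraph \<Rightarrow> ('p \<Rightarrow> 'a) \<Rightarrow> bool" where
  "surj_weak_hom P H f \<longleftrightarrow> weak_hom P H f \<and> f ` pverts P = pverts H"

text \<open>
  With all arc weights 1, \<open>\<mu>\<close> is the least number of arcs of a walk from \<open>u\<close> to \<open>v\<close>
  (\<open>\<infinity>\<close> if there is none).
\<close>

definition graph_dist :: "'a pair_pre_digraph \<Rightarrow> 'a \<Rightarrow> 'a \<Rightarrow> ereal" where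
  "graph_dist H u v = wf_digraph.\<mu> (with_proj H) (\<lambda>_. 1) u v"

lemma graph_dist_eq:
  assumes "pair_graph H"
  shows "graph_dist H u v = (INF p\<in>{p. pre_digraph.awalk (with_proj H) u p v}. ereal (real (length p)))"
proof -
  interpret pair_graph H by fact
  have "awalk_cost (\<lambda>_. 1) p = real (length p)" for p :: "('a \<times> 'a) list"
    by (induction p) auto
  then show ?thesis
    unfolding graph_dist_def \<mu>_def by simp
qed

definition min_dist ::
  "'p pair_pre_digraph \<Rightarrow> 'a pair_pre_digraph \<Rightarrow> ('p \<Rightarrow> 'a) \<Rightarrow> ('p \<Rightarrow> 'a) \<Rightarrow> ereal" where
  "min_dist P H f g = Min ((\<lambda>u. graph_dist H (f u) (g u)) ` pverts P)"

definition strong_vertex_span :: "'a pair_pre_digraph \<Rightarrow> ereal" where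
  "strong_vertex_span H = Max {min_dist (path_graph n) H f g | n f g.
     n > 0 \<and> surj_weak_hom (path_graph n) H f \<and> surj_weak_hom (path_graph n) H g}"

lemma pair_graph_aug:
  assumes "pair_graph G" "pair_graph H" "pverts G \<inter> pverts H = {}" "S \<subseteq> pverts G"
  shows "pair_graph (aug G S H)"
proof -
  interpret G: pair_graph G by fact
  interpret H: pair_graph H by fact
  have fin: "finite S"
    using assms(4) G.pair_finite_verts finite_subset by blast
  show ?thesis
  proof
    show "symmetric (with_proj (aug G S H))"
      using G.arcs_symmetric H.arcs_symmetric
      by (auto simp: symmetric_def aug_def intro!: symI)
  qed (use assms(3,4) fin G.pair_finite_verts H.pair_finite_verts G.pair_finite_arcs
        H.pair_finite_arcs in \<open>auto simp: aug_def dest: G.in_arcsD1 G.in_arcsD2 H.in_arcsD1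
        H.in_arcsD2 G.no_loops' H.no_loops'\<close>)
qed

lemma pair_graph_path_graph: "pair_graph (path_graph n)"
proof
  show "finite (parcs (path_graph n))"
    by (rule finite_subset[of _ "{..<n} \<times> {..<n}"]) (auto simp: path_graph_def)
qed (auto simp: path_graph_def symmetric_def intro!: symI)

text \<open>The maximum in the definition of the span is over a finite set.\<close>

lemma finite_min_dists:
  assumes "finite (pverts H)"
  shows "finite {min_dist (path_graph n) H f g | n f g.
     n > 0 \<and> surj_weak_hom (path_graph n) H f \<and> surj_weak_hom (path_graph n) H g}"
proof (rule finite_subset)
  show "finite ((\<lambda>(u, v). graph_dist H u v) ` (pverts H \<times> pverts H))"
    using assms by blast
  have "min_dist (path_graph n) H f g \<in> (\<lambda>(u, v). graph_dist H u v) ` (pverts H \<times> pverts H)"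
    if n: "n > 0" and f: "surj_weak_hom (path_graph n) H f" and g: "surj_weak_hom (path_graph n) H g"
    for n and f g :: "nat \<Rightarrow> 'a"
  proof -
    have "min_dist (path_graph n) H f g \<in> (\<lambda>u. graph_dist H (f u) (g u)) ` pverts (path_graph n)"
      unfolding min_dist_def using n by (intro Min_in) (auto simp: path_graph_def)
    then obtain u where "u \<in> pverts (path_graph n)" "min_dist (path_graph n) H f g = graph_dist H (f u) (g u)"
      by blast
    moreover from this have "(f u, g u) \<in> pverts H \<times> pverts H"
      using f g unfolding surj_weak_hom_def by blast
    ultimately show ?thesis
      by force
  qed
  then show "{min_dist (path_graph n) H f g | n f g.
     n > 0 \<and> surj_weak_hom (path_graph n) H f \<and> surj_weak_hom (path_graph n) H g}
     \<subseteq> (\<lambda>(u, v). graph_dist H u v) ` (pverts H \<times> pverts H)"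
    by blast
qed

end

theory Submission
  imports Defs
begin

text \<open>
  For the upper bound, a maximal clique \<open>K\<close> of an interval graph consists of exactly the vertices
  whose interval contains some point \<open>p\<close>, so every vertex of \<open>H\<close> may be given the degenerate
  interval \<open>[p, p]\<close>; only adjacency inside \<open>H\<close> is misrepresented. If two players walk through the
  augmented graph and are never equal or adjacent, they are never both in \<open>H\<close>, as they could not
  leave \<open>H\<close> again. So their intervals are always disjoint, and the one that is to the left at
  the beginning stays to the left. This is impossible: each of them is at the end-vertex
  at some time, and nothing lies on one side of the interval of the end-vertex.

  For the lower bound, let the players follow the same closed walk through all vertices, one of
  them a step ahead of the other.
\<close>

section \<open>Covering closed walks and the lower bound\<close>

text \<open>Closed walks at \<open>a\<close>, one through each vertex, are concatenated. Tails and
  heads must both cover, since each of them becomes the trajectory of one player. The second vertex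
  \<open>b\<close> ensures, with connectedness, that every vertex has a neighbour.\<close>

lemma closed_walk_covering:
  assumes "pair_graph G" "Digraph_Component.strongly_connected (with_proj G)"
    and "a \<in> pverts G" "b \<in> pverts G" "a \<noteq> b"
  obtains p where "pre_digraph.awalk (with_proj G) a p a" "fst ` set p = pverts G"
    "snd ` set p = pverts G"
proof -
  interpret pair_graph G by fact
  have reach: "x \<rightarrow>\<^sup>*\<^bsub>with_proj G\<^esub> y" if "x \<in> pverts G" "y \<in> pverts G" for x y
    using assms(2) that by auto
  have neighbour: "\<exists>y. (x, y) \<in> parcs G" if "x \<in> pverts G" for x
  proof -
    obtain y where y: "y \<in> pverts G" "x \<noteq> y" using assms(3-5) by metis
    show ?thesis
      using reach[OF that y(1)] y(2) by (cases rule: converse_reachable_cases) auto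
  qed
  have single: "\<exists>p. awalk a p a \<and> x \<in> fst ` set p \<and> x \<in> snd ` set p" if x: "x \<in> pverts G" for x
  proof -
    obtain y where y: "(x, y) \<in> parcs G" using neighbour[OF x] by blast
    then have yx: "(y, x) \<in> parcs G" using arcs_symmetric by blast
    obtain q r where q: "awalk a q x" and r: "awalk x r a"
      using reach[OF assms(3) x] reach[OF x assms(3)] unfolding reachable_awalk by blast
    \<comment> \<open>The detour from \<open>x\<close> to \<open>y\<close> and back makes
      \<open>x\<close> both a tail and a head, even if \<open>q\<close> and \<open>r\<close> are
      empty, as may happen for \<open>x = a\<close>.\<close>
    have "awalk x ((x, y) # (y, x) # r) a"
      using y yx r by (auto simp: awalk_Cons_iff)
    with q have "awalk a (q @ (x, y) # (y, x) # r) a" by (rule awalk_appendI)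
    then show ?thesis by (intro exI[of _ "q @ (x, y) # (y, x) # r"]) force
  qed
  have "\<exists>p. awalk a p a \<and> S \<subseteq> fst ` set p \<and> S \<subseteq> snd ` set p"
    if "finite S" "S \<subseteq> pverts G" for S
    using that
  proof induction
    case empty
    then show ?case using assms(3) by (intro exI[of _ "[]"]) (simp add: awalk_Nil_iff)
  next
    case (insert x S)
    then obtain p q where p: "awalk a p a" "S \<subseteq> fst ` set p" "S \<subseteq> snd ` set p"
      and q: "awalk a q a" "x \<in> fst ` set q" "x \<in> snd ` set q"
      using single[of x] by auto
    have "awalk a (p @ q) a" using p(1) q(1) by (rule awalk_appendI)
    with p q show ?case by (intro exI[of _ "p @ q"]) (auto simp: image_Un)
  qed
  from this[OF pair_finite_verts] obtain p where p: "awalk a p a"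
    "pverts G \<subseteq> fst ` set p" "pverts G \<subseteq> snd ` set p" by blast
  moreover from p(1) have "set p \<subseteq> parcs G" by blast
  ultimately show ?thesis
    using that[of p] arc_fst_in_verts arc_snd_in_verts by blast
qed

lemma awalk_consecutive:
  assumes "pre_digraph.awalk (with_proj G) u p v" "Suc i < length p"
  shows "snd (p ! i) = fst (p ! Suc i)"
proof -
  have "pcas u p v"
    using assms(1) by (simp add: pre_digraph.awalk_def cas_with_proj_eq)
  then show ?thesis
    using assms(2)
  proof (induction p arbitrary: u i)
    case (Cons e p)
    then show ?case by (cases i; cases p) auto
  qed simp
qed

lemma graph_dist_le_1:
  assumes "pair_graph G" "u \<in> pverts G" "u = v \<or> (u, v) \<in> parcs G"
  shows "graph_dist G u v \<le> 1"
proof -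
  interpret pair_graph G by fact
  have "\<exists>p. awalk u p v \<and> length p \<le> 1"
    using assms(2,3)
  proof (elim disjE)
    assume "u = v"
    with assms(2) show ?thesis by (intro exI[of _ "[]"]) (simp add: awalk_Nil_iff)
  next
    assume "(u, v) \<in> parcs G"
    then show ?thesis
      by (intro exI[of _ "[(u, v)]"]) (auto simp: awalk_Cons_iff awalk_Nil_iff wellformed')
  qed
  then show ?thesis
    unfolding graph_dist_eq[OF assms(1)]
    by (auto intro!: INF_lower2 simp: one_ereal_def)
qed

lemma graph_dist_arc:
  assumes "pair_graph G" "(u, v) \<in> parcs G"
  shows "graph_dist G u v = 1"
proof (rule antisym)
  interpret pair_graph G by fact
  show "graph_dist G u v \<le> 1"
    using graph_dist_le_1[OF assms(1) in_arcsD1[OF assms(2)]] assms(2) by simp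
  have "u \<noteq> v" using pair_no_loops[OF assms(2)] by simp
  then have "1 \<le> length p" if "awalk u p v" for p
    using that by (cases p) (auto simp: awalk_Nil_iff)
  then show "1 \<le> graph_dist G u v"
    unfolding graph_dist_eq[OF assms(1)]
    by (auto intro!: INF_greatest simp: one_ereal_def)
qed

text \<open>One player reads the tails and the other the heads of the arcs of a covering closed
  walk, so at every time they occupy the two ends of a single arc and their distance is exactly
  1.\<close>

lemma min_dist_1_attained:
  assumes "pair_graph G" "Digraph_Component.strongly_connected (with_proj G)"
    and "a \<in> pverts G" "b \<in> pverts G" "a \<noteq> b"
  obtains n f g where "n > 0" "surj_weak_hom (path_graph n) G f" "surj_weak_hom (path_graph n) G g"
    "min_dist (path_graph n) G f g = 1"
proof -
  interpret pair_graph G by fact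
  obtain p where p: "awalk a p a" "fst ` set p = pverts G" "snd ` set p = pverts G"
    using closed_walk_covering[OF assms] .
  define f where "f i = fst (p ! i)" for i
  define g where "g i = snd (p ! i)" for i
  have arc: "(f i, g i) \<in> parcs G" if "i < length p" for i
  proof -
    have "p ! i \<in> parcs G" using p(1) nth_mem[OF that] by blast
    then show ?thesis by (simp add: f_def g_def)
  qed
  \<comment> \<open>Hence \<open>f\<close> moves at time \<open>i\<close> along the arc number
    \<open>i\<close>, and \<open>g\<close> along the arc after it.\<close>
  have shift: "g i = f (Suc i)" if "Suc i < length p" for i
    using awalk_consecutive[OF p(1) that] by (simp add: f_def g_def)
  have im: "f ` {..<length p} = pverts G" "g ` {..<length p} = pverts G"
    using p(2,3) by (auto simp: f_def g_def set_conv_nth)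
  have adj: "(f i, f (Suc i)) \<in> parcs G" "(g i, g (Suc i)) \<in> parcs G"
    if "Suc i < length p" for i
    using arc[of i] arc[of "Suc i"] shift[OF that] that by auto
  have hom: "surj_weak_hom (path_graph (length p)) G f" "surj_weak_hom (path_graph (length p)) G g"
    using im adj adj[THEN arcs_symmetric]
    by (auto simp: surj_weak_hom_def weak_hom_def path_graph_def)
  have ne: "length p > 0" using p(2) assms(3) by auto
  have "(\<lambda>i. graph_dist G (f i) (g i)) ` {..<length p} = {1}"
    using arc graph_dist_arc[OF assms(1)] ne by (auto simp: image_iff)
  then have "min_dist (path_graph (length p)) G f g = 1"
    by (simp add: min_dist_def path_graph_def)
  with hom ne show ?thesis using that by blast
qed

text \<open>Any \<open>s\<close> in \<open>S\<close> is a hub: vertices of \<open>G\<close> are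
  linked to it inside \<open>G\<close>, and those of \<open>H\<close> are adjacent to it.\<close>

lemma aug_strongly_connected:
  assumes "pair_graph G" "Digraph_Component.connected (with_proj G)"
    and "pair_graph H" "pverts G \<inter> pverts H = {}" "S \<subseteq> pverts G" "S \<noteq> {}"
  shows "Digraph_Component.strongly_connected (with_proj (aug G S H))"
proof -
  interpret G: pair_graph G by fact
  interpret A: pair_graph "aug G S H"
    using pair_graph_aug[OF assms(1,3,4,5)] .
  obtain s where s: "s \<in> S" using assms(6) by blast
  have G: "x \<rightarrow>\<^sup>*\<^bsub>with_proj (aug G S H)\<^esub> y" if "x \<in> pverts G" "y \<in> pverts G" for x y
  proof -
    have "Digraph_Component.strongly_connected (with_proj G)"
      using G.symmetric_connected_imp_strongly_connected[OF G.sym_arcs assms(2)] .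
    then have "x \<rightarrow>\<^sup>*\<^bsub>with_proj G\<^esub> y" using that by auto
    then show ?thesis
      unfolding reachable_def
      by (rule rtrancl_on_mono[rotated 2]) (auto simp: aug_def)
  qed
  have hub: "s \<rightarrow>\<^sup>*\<^bsub>with_proj (aug G S H)\<^esub> x" "x \<rightarrow>\<^sup>*\<^bsub>with_proj (aug G S H)\<^esub> s"
    if "x \<in> pverts (aug G S H)" for x
  proof -
    have "(s, x) \<in> parcs (aug G S H) \<and> (x, s) \<in> parcs (aug G S H)" if "x \<notin> pverts G"
      using s that \<open>x \<in> pverts (aug G S H)\<close> by (auto simp: aug_def)
    then show "s \<rightarrow>\<^sup>*\<^bsub>with_proj (aug G S H)\<^esub> x" "x \<rightarrow>\<^sup>*\<^bsub>with_proj (aug G S H)\<^esub> s"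
      using G[of s x] G[of x s] s assms(5) by (blast intro: A.reachable_adjI)+
  qed
  show ?thesis
  proof
    show "verts (with_proj (aug G S H)) \<noteq> {}" using s assms(5) by (auto simp: aug_def)
  qed (use hub in \<open>simp, blast intro: A.reachable_trans\<close>)
qed

section \<open>Interval geometry and the upper bound\<close>

text \<open>Helly property of the line: pairwise intersecting intervals share their rightmost left
  end. A vertex whose interval contains that point is adjacent to all other vertices of
  \<open>K\<close>, so maximality puts it into \<open>K\<close>.\<close>

lemma maximal_clique_point:
  assumes "interval_rep G l r" "maximal_clique G K" "finite (pverts G)" "K \<noteq> {}"
  obtains p where "\<And>u. u \<in> pverts G \<Longrightarrow> u \<in> K \<longleftrightarrow> l u \<le> p \<and> p \<le> r u"
proof -
  have cl: "clique G K" and K: "K \<subseteq> pverts G"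
    using assms(2) by (auto simp: maximal_clique_def clique_def)
  then have fin: "finite K" using assms(3) finite_subset by blast
  define p where "p = Max (l ` K)"
  have "p \<in> l ` K" unfolding p_def using fin assms(4) by (intro Max_in) auto
  then obtain w where w: "w \<in> K" "p = l w" by blast
  have lp: "l u \<le> p" if "u \<in> K" for u
    unfolding p_def using fin that by auto
  have adj: "(u, v) \<in> parcs G \<longleftrightarrow> l u \<le> r v \<and> l v \<le> r u"
    if "u \<in> pverts G" "v \<in> pverts G" "u \<noteq> v" for u v
  proof -
    have "l u \<le> r u" "l v \<le> r v"
      and *: "(u, v) \<in> parcs G \<longleftrightarrow> {l u..r u} \<inter> {l v..r v} \<noteq> {}"
      using assms(1) that by (auto simp: interval_rep_def)
    then show ?thesis by (auto simp: *)
  qed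
  have pr: "p \<le> r u" if "u \<in> K" for u
  proof (cases "u = w")
    case True
    then show ?thesis using w K assms(1) by (auto simp: interval_rep_def)
  next
    case False
    then have "(u, w) \<in> parcs G" using cl that w(1) by (auto simp: clique_def pairwise_def)
    then show ?thesis using adj[of u w] that w K False by auto
  qed
  have "u \<in> K" if u: "u \<in> pverts G" "l u \<le> p" "p \<le> r u" for u
  proof -
    have "(u, x) \<in> parcs G \<and> (x, u) \<in> parcs G" if "x \<in> K" "x \<noteq> u" for x
      using adj[of u x] adj[of x u] that u K lp[OF that(1)] pr[OF that(1)] by auto
    then have "clique G (insert u K)"
      using cl u(1) by (auto simp: clique_def pairwise_insert)
    then show ?thesis
      using assms(2) unfolding maximal_clique_def by blast
  qed
  with lp pr show ?thesis using that by blast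
qed

text \<open>For \<open>[a i, b i]\<close> to the left of \<open>[c i, d i]\<close>, a change of
  sides would need \<open>d (Suc i) < a (Suc i)\<close>; but consecutive intervals meet, so
  \<open>a (Suc i) \<le> b i < c i \<le> d (Suc i)\<close>.\<close>

lemma disjoint_intervals_keep_order:
  fixes a b c d :: "nat \<Rightarrow> 'a::linorder"
  assumes disj: "\<And>i. i < n \<Longrightarrow> b i < c i \<or> d i < a i"
    and meet: "\<And>i. Suc i < n \<Longrightarrow> a i \<le> b (Suc i) \<and> a (Suc i) \<le> b i"
      "\<And>i. Suc i < n \<Longrightarrow> c i \<le> d (Suc i) \<and> c (Suc i) \<le> d i"
  shows "(\<forall>i<n. b i < c i) \<or> (\<forall>i<n. d i < a i)"
proof -
  \<comment> \<open>An equivalence, so that the failure of \<open>b 0 < c 0\<close> also propagates;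
    by \<open>disj\<close> that failure is the opposite order.\<close>
  have step: "b i < c i \<longleftrightarrow> b (Suc i) < c (Suc i)" if "Suc i < n" for i
  proof
    assume "b i < c i"
    then have "a (Suc i) < d (Suc i)"
      using meet[OF that] by (meson le_less_trans less_le_trans)
    then show "b (Suc i) < c (Suc i)" using disj[OF that] by auto
  next
    assume "b (Suc i) < c (Suc i)"
    then have "a i < d i"
      using meet[OF that] by (meson le_less_trans less_le_trans)
    then show "b i < c i" using disj[of i] that by auto
  qed
  have "b i < c i \<longleftrightarrow> b 0 < c 0" if "i < n" for i
    using that by (induction i) (auto simp: step[symmetric])
  then show ?thesis using disj by blast
qed

text \<open>\<open>L\<close> and \<open>R\<close> extend the representation by \<open>[p, p]\<close>
  on \<open>H\<close>. Adjacent vertices then always have meeting intervals, and nonadjacent ones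
  have disjoint intervals unless both lie in \<open>H\<close>. Once that case is excluded for the
  players, their intervals keep their order.\<close>

lemma aug_avoiding_players_ordered:
  assumes G: "pair_graph G" "interval_rep G l r" and K: "maximal_clique G K" "K \<noteq> {}"
    and H: "pair_graph H" "pverts G \<inter> pverts H = {}"
    and f: "surj_weak_hom (path_graph n) (aug G K H) f"
    and g: "surj_weak_hom (path_graph n) (aug G K H) g"
    and avoid: "\<And>i. i < n \<Longrightarrow> f i \<noteq> g i \<and> (f i, g i) \<notin> parcs (aug G K H)"
    and p: "\<And>u. u \<in> pverts G \<Longrightarrow> u \<in> K \<longleftrightarrow> l u \<le> p \<and> p \<le> r u"
    and L: "L = (\<lambda>u. if u \<in> pverts G then l u else p)"
    and R: "R = (\<lambda>u. if u \<in> pverts G then r u else p)"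
  shows "(\<forall>i<n. R (f i) < L (g i)) \<or> (\<forall>i<n. R (g i) < L (f i))"
proof -
  interpret G: pair_graph G by fact
  interpret H: pair_graph H by fact
  let ?A = "aug G K H"
  have KG: "K \<subseteq> pverts G" using K by (auto simp: maximal_clique_def clique_def)
  interpret A: pair_graph ?A
    using pair_graph_aug[OF G(1) H KG] .
  have LR: "L u \<le> R u" if "u \<in> pverts ?A" for u
    using G(2) that by (auto simp: L R interval_rep_def)
  have meets: "L u \<le> R v \<and> L v \<le> R u"
    if uv: "(u, v) \<in> parcs ?A \<or> u = v" "u \<in> pverts ?A" "v \<in> pverts ?A" for u v
  proof (cases "u = v")
    case True
    then show ?thesis using LR uv by auto
  next
    case False
    then have "(u, v) \<in> parcs ?A" using uv by simp
    then consider "(u, v) \<in> parcs G" "u \<in> pverts G" "v \<in> pverts G"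
      | "u \<in> pverts H" "v \<in> pverts H" | "u \<in> K" "v \<in> pverts H" | "u \<in> pverts H" "v \<in> K"
      by (auto simp: aug_def dest: G.wellformed' H.wellformed')
    then show ?thesis
    proof cases
      case 1
      then show ?thesis
        using G(2) False unfolding interval_rep_def L R by fastforce
    next
      case 2
      then show ?thesis using H(2) by (auto simp: L R)
    next
      case 3
      then show ?thesis using H(2) KG p[of u] by (auto simp: L R)
    next
      case 4
      then show ?thesis using H(2) KG p[of v] by (auto simp: L R)
    qed
  qed
  \<comment> \<open>If one vertex lies in \<open>H\<close>, the other is outside \<open>K\<close>,
    so its interval misses \<open>p\<close>. Two vertices of \<open>H\<close> are left out because
    both have \<open>[p, p]\<close>.\<close>
  have apart: "R u < L v \<or> R v < L u"
    if uv: "u \<in> pverts ?A" "v \<in> pverts ?A" "u \<noteq> v" "(u, v) \<notin> parcs ?A" "u \<in> pverts G \<or> v \<in> pverts G"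
    for u v
  proof -
    consider "u \<in> pverts G" "v \<in> pverts G" | "u \<in> pverts G" "v \<in> pverts H"
      | "u \<in> pverts H" "v \<in> pverts G"
      using uv(1,2,5) by (auto simp: aug_def)
    then show ?thesis
    proof cases
      case 1
      then have "{l u..r u} \<inter> {l v..r v} = {}" "l u \<le> r u" "l v \<le> r v"
        using G(2) uv(3,4) by (auto simp: interval_rep_def aug_def)
      then show ?thesis using 1 by (auto simp: L R)
    next
      case 2
      then have "u \<notin> K" "v \<notin> pverts G" using uv(4) H(2) by (auto simp: aug_def)
      then show ?thesis using 2 p[of u] by (auto simp: L R)
    next
      case 3
      then have "v \<notin> K" "u \<notin> pverts G" using uv(4) H(2) by (auto simp: aug_def)
      then show ?thesis using 3 p[of v] by (auto simp: L R)
    qed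
  qed
  have step: "h i \<in> pverts ?A" "Suc i < n \<Longrightarrow> (h i, h (Suc i)) \<in> parcs ?A \<or> h i = h (Suc i)"
    "\<exists>j<n. h j \<in> K"
    if "surj_weak_hom (path_graph n) ?A h" "i < n" for h i
  proof -
    have im: "h ` {..<n} = pverts ?A"
      and *: "\<forall>(u, v)\<in>parcs (path_graph n). (h u, h v) \<in> parcs ?A \<or> h u = h v"
      using that(1) by (auto simp: surj_weak_hom_def weak_hom_def path_graph_def)
    show "h i \<in> pverts ?A" using im that(2) by auto
    show "(h i, h (Suc i)) \<in> parcs ?A \<or> h i = h (Suc i)" if "Suc i < n"
    proof -
      have "(i, Suc i) \<in> parcs (path_graph n)" using that by (auto simp: path_graph_def)
      then show ?thesis using * by blast
    qed
    obtain k where "k \<in> K" using K(2) by blast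
    then have "k \<in> h ` {..<n}" unfolding im using KG by (auto simp: aug_def)
    then show "\<exists>j<n. h j \<in> K" using \<open>k \<in> K\<close> by auto
  qed
  define both where "both i \<longleftrightarrow> f i \<in> pverts H \<and> g i \<in> pverts H" for i
  \<comment> \<open>From \<open>H\<close> a move leads only to \<open>H\<close> or \<open>K\<close>.
    Since \<open>K\<close> is a clique joined to all of \<open>H\<close>, two distinct nonadjacent
    vertices of \<open>pverts H \<union> K\<close> both lie in \<open>H\<close>. The argument works
    forwards and backwards in time.\<close>
  have stay: "both (Suc i) \<longleftrightarrow> both i" if i: "Suc i < n" for i
  proof -
    have HK: "u \<in> pverts H \<Longrightarrow> v \<in> pverts H \<union> K"
      if "(u, v) \<in> parcs ?A \<or> (v, u) \<in> parcs ?A \<or> u = v" for u v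
      using that H(2) by (auto simp: aug_def dest: G.wellformed' H.wellformed')
    have col: "u \<in> pverts H \<and> v \<in> pverts H"
      if "u \<in> pverts H \<union> K" "v \<in> pverts H \<union> K" "u \<noteq> v" "(u, v) \<notin> parcs ?A" for u v
    proof -
      have "(u, v) \<in> parcs G" if "u \<in> K" "v \<in> K"
        using K(1) that \<open>u \<noteq> v\<close> by (auto simp: maximal_clique_def clique_def pairwise_def)
      then show ?thesis using that by (auto simp: aug_def)
    qed
    have i': "i < n" using i by simp
    have "f i \<in> pverts H \<Longrightarrow> f (Suc i) \<in> pverts H \<union> K"
      "f (Suc i) \<in> pverts H \<Longrightarrow> f i \<in> pverts H \<union> K"
      using step(2)[OF f i' i] HK by metis+
    moreover have "g i \<in> pverts H \<Longrightarrow> g (Suc i) \<in> pverts H \<union> K"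
      "g (Suc i) \<in> pverts H \<Longrightarrow> g i \<in> pverts H \<union> K"
      using step(2)[OF g i' i] HK by metis+
    ultimately show ?thesis
      using col[of "f i" "g i"] col[of "f (Suc i)" "g (Suc i)"] avoid[OF i] avoid[OF i']
      unfolding both_def by metis
  qed
  have "both i \<longleftrightarrow> both 0" if "i < n" for i
    using that by (induction i) (auto simp: stay)
  \<comment> \<open>By surjectivity \<open>f\<close> visits \<open>K\<close>, which is disjoint from
    \<open>H\<close>; one such time rules out \<open>both\<close> at all times.\<close>
  moreover have "\<exists>j<n. \<not> both j" if "i < n" for i
    using step(3)[OF f that] KG H(2) by (auto simp: both_def)
  ultimately have not_both: "\<not> both i" if "i < n" for i using that by blast
  show ?thesis
  proof (rule disjoint_intervals_keep_order)
    fix i assume i: "i < n"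
    show "R (f i) < L (g i) \<or> R (g i) < L (f i)"
      using apart[OF step(1)[OF f i] step(1)[OF g i]] avoid[OF i] not_both[OF i]
        step(1)[OF f i] step(1)[OF g i] by (auto simp: both_def aug_def)
  next
    fix i assume i: "Suc i < n"
    then have i': "i < n" by simp
    show "L (f i) \<le> R (f (Suc i)) \<and> L (f (Suc i)) \<le> R (f i)"
      using meets[OF step(2)[OF f i' i] step(1)[OF f i'] step(1)[OF f i]] .
    show "L (g i) \<le> R (g (Suc i)) \<and> L (g (Suc i)) \<le> R (g i)"
      using meets[OF step(2)[OF g i' i] step(1)[OF g i'] step(1)[OF g i]] .
  qed
qed

lemma aug_end_clique_players_meet:
  assumes G: "pair_graph G" and K: "end_clique G K"
    and H: "pair_graph H" "pverts G \<inter> pverts H = {}"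
    and f: "surj_weak_hom (path_graph n) (aug G K H) f"
    and g: "surj_weak_hom (path_graph n) (aug G K H) g"
  shows "\<exists>i<n. f i = g i \<or> (f i, g i) \<in> parcs (aug G K H)"
proof (rule ccontr)
  assume "\<not> ?thesis"
  then have avoid: "\<And>i. i < n \<Longrightarrow> f i \<noteq> g i \<and> (f i, g i) \<notin> parcs (aug G K H)" by blast
  interpret G: pair_graph G by fact
  obtain v l r where mc: "maximal_clique G K" and v: "v \<in> K" "v \<in> pverts G"
    and rep: "interval_rep G l r" and ext: "l v = Min (l ` pverts G) \<or> r v = Max (r ` pverts G)"
    using K unfolding end_clique_def end_vertex_def by blast
  have ne: "K \<noteq> {}" using v by blast
  obtain p where p: "\<And>u. u \<in> pverts G \<Longrightarrow> u \<in> K \<longleftrightarrow> l u \<le> p \<and> p \<le> r u"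
    by (rule maximal_clique_point[OF rep mc G.pair_finite_verts ne]) (rule that)
  define L where "L = (\<lambda>u. if u \<in> pverts G then l u else p)"
  define R where "R = (\<lambda>u. if u \<in> pverts G then r u else p)"
  \<comment> \<open>Both ends default to \<open>p\<close> outside \<open>pverts G\<close>, so this
    holds for every \<open>u\<close>.\<close>
  have LR: "L u \<le> R u" for u
    using rep by (auto simp: L_def R_def interval_rep_def)
  have order: "(\<forall>i<n. R (f i) < L (g i)) \<or> (\<forall>i<n. R (g i) < L (f i))"
    by (rule aug_avoiding_players_ordered[OF G rep mc ne H f g avoid p L_def R_def])
  have im: "f ` {..<n} = pverts (aug G K H)" "g ` {..<n} = pverts (aug G K H)"
    using f g by (auto simp: surj_weak_hom_def path_graph_def)
  moreover have "v \<in> pverts (aug G K H)" using v by (simp add: aug_def)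
  ultimately have "v \<in> f ` {..<n}" "v \<in> g ` {..<n}" by simp_all
  then obtain s t where st: "s < n" "f s = v" "t < n" "g t = v" by auto
  from ext show False
  proof
    assume "l v = Min (l ` pverts G)"
    \<comment> \<open>For \<open>u\<close> outside \<open>G\<close> the left end is
      \<open>p\<close>, and \<open>l v \<le> p\<close> because \<open>v\<close> is in
      \<open>K\<close>: the end-vertex stays extreme after the extension.\<close>
    then have "L v \<le> L u" for u
      using v p[of v] G.pair_finite_verts by (auto simp: L_def)
    then have "\<not> R u < L v" for u using LR order.trans unfolding not_less by blast
    \<comment> \<open>If \<open>f\<close> keeps to the left, time \<open>t\<close> puts
      \<open>f t\<close> to the left of \<open>v = g t\<close>; if \<open>g\<close> does, time
      \<open>s\<close> puts \<open>g s\<close> to the left of \<open>v = f s\<close>.\<close>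
    then show False using order st by metis
  next
    assume "r v = Max (r ` pverts G)"
    then have "R u \<le> R v" for u
      using v p[of v] G.pair_finite_verts by (auto simp: R_def)
    then have "\<not> R v < L u" for u using LR order.trans unfolding not_less by blast
    then show False using order st by metis
  qed
qed

section \<open>The two bounds combined\<close>

theorem theorem3p8:
  fixes G H :: "'a pair_pre_digraph" and K :: "'a set"
  assumes "interval_graph G" and "Digraph_Component.connected (with_proj G)"
    and "end_clique G K"
    and "pair_graph H" and "Digraph_Component.connected (with_proj H)"
    and "pverts G \<inter> pverts H = {}"
  shows "strong_vertex_span (aug G K H) = 1"
proof -
  let ?A = "aug G K H"
  have G: "pair_graph G" using assms(1) by (simp add: interval_graph_def)
  obtain k where k: "k \<in> K" and KG: "K \<subseteq> pverts G"
    using assms(3) by (auto simp: end_clique_def maximal_clique_def clique_def)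
  obtain h where h: "h \<in> pverts H"
    using assms(5) by (auto simp: connected_def strongly_connected_def)
  have A: "pair_graph ?A" using pair_graph_aug[OF G assms(4,6) KG] .
  interpret A: pair_graph ?A by (fact A)
  have sc: "Digraph_Component.strongly_connected (with_proj ?A)"
    using aug_strongly_connected[OF G assms(2,4,6) KG] k by blast
  show ?thesis
    unfolding strong_vertex_span_def
  proof (rule Max_eqI)
    show "finite {min_dist (path_graph n) ?A f g | n f g.
      n > 0 \<and> surj_weak_hom (path_graph n) ?A f \<and> surj_weak_hom (path_graph n) ?A g}"
      using finite_min_dists[OF A.pair_finite_verts] .
  next
    \<comment> \<open>The clique and \<open>H\<close> supply the two distinct vertices that the
      covering closed walk requires.\<close>
    have kh: "k \<in> pverts ?A" "h \<in> pverts ?A" "k \<noteq> h"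
      using k KG h assms(6) by (auto simp: aug_def)
    show "1 \<in> {min_dist (path_graph n) ?A f g | n f g.
      n > 0 \<and> surj_weak_hom (path_graph n) ?A f \<and> surj_weak_hom (path_graph n) ?A g}"
      by (rule min_dist_1_attained[OF A sc kh]) (rule CollectI, metis)
  next
    fix y
    assume "y \<in> {min_dist (path_graph n) ?A f g | n f g.
      n > 0 \<and> surj_weak_hom (path_graph n) ?A f \<and> surj_weak_hom (path_graph n) ?A g}"
    then obtain n f g where y: "y = min_dist (path_graph n) ?A f g"
      and f: "surj_weak_hom (path_graph n) ?A f" and g: "surj_weak_hom (path_graph n) ?A g"
      by blast
    \<comment> \<open>At such a time the distance is at most 1, and the minimum \<open>y\<close> is
      no larger.\<close>
    obtain i where i: "i < n" "f i = g i \<or> (f i, g i) \<in> parcs ?A"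
      using aug_end_clique_players_meet[OF G assms(3,4,6) f g] by blast
    have "f i \<in> pverts ?A" using f i(1) by (auto simp: surj_weak_hom_def path_graph_def)
    then have "graph_dist ?A (f i) (g i) \<le> 1" using graph_dist_le_1[OF A] i(2) by blast
    moreover have "y \<le> graph_dist ?A (f i) (g i)"
      unfolding y min_dist_def using i(1) by (intro Min_le) (auto simp: path_graph_def)
    ultimately show "y \<le> 1" by simp
  qed
qed

end
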